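(* Let $n\ge 1$ and let $\sigma\in D_n\cup E_n$ with $\sigma\neq\pi_n$. If $\sigma\in D_n$, then $\lambda_n(\sigma)\in E_n$. If $\sigma\in E_n$, then $\lambda_n(\sigma)\in D_n$. Moreover, $\lambda_n(\lambda_n(\sigma))=\sigma$.
   Context: For $n \geq 0$ let $\mathfrak{S}_n$ be the set of permutations of $[n]=\{1,\dots,n\}$ ($\mathfrak{S}_0$ consists of the empty permutation $()$), written in disjoint cycle notation. Let $D_n\subseteq \mathfrak{S}_n$ be the set of derangements (permutations with no fixed point) and $E_n \subseteq \mathfrak{S}_n$ the set of permutations with exactly one fixed point. Define $\pi_n = (1\,2)(3\,4)\cdots(n-1\;n)$ if $n$ is even and $\pi_n=(1\,2)(3\,4)\cdots(n-2\;\,n-1)(n)$ if $n$ is odd; so $\pi_0=()$, $\pi_1=(1)$, $\pi_n\in D_n$ for $n$ even and $\pi_n \in E_n$ for $n$ odd. Let $\Pi_n=\{\pi_n\}$. For $\sigma\in\mathfrak{S}_n$ and $a\in[n]$, $\sigma\setminus a$ denotes the permutation of $[n]\setminus\{a\}$ obtained by deleting $a$ from the disjoint cycle decomposition of $\sigma$: $(\sigma\setminus a)(x)=\sigma(x)$ if $\sigma(x)\neq a$, and $(\sigma\setminus a)(\sigma^{-1}(a))=\sigma(a)$ if $\sigma(a)\ne a$ (if $a$ is a fixed point, it is simply removed). For $n\ge 1$ define the bijection $f_n:[n]\times D_{n-1}\to E_n$ by: for $m<n$, $f_n(m,\sigma)$ is the permutation $\tau$ of $[n]$ obtained by replacing $m$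 by $n$ in the cycle decomposition of $\sigma$ and adding the fixed point $m$ (i.e. $\tau(m)=m$, $\tau(\sigma^{-1}(m))=n$, $\tau(n)=\sigma(m)$, $\tau(x)=\sigma(x)$ otherwise); and $f_n(n,\sigma)$ is $\sigma$ with the fixed point $n$ appended. Define bijections $\alpha_n$ recursively: for $n$ even, $\alpha_n: D_n\to E_n\sqcup \Pi_n$; for $n$ odd, $\alpha_n: D_n\sqcup\Pi_n\to E_n$ (these unions are disjoint). Let $\alpha_0$ send $()$ to $\pi_0$ and $\alpha_1$ send $\pi_1$ to $(1)$. For $n\ge 2$ and $\sigma$ in the domain of $\alpha_n$, with $\alpha_{n-1}^{-1}$ the inverse of the bijection $\alpha_{n-1}$: (i) if $\sigma\in D_n$ and $n$ lies in a cycle of $\sigma$ of length at least $3$, then $\alpha_n(\sigma)=f_n(\sigma(n),\sigma\setminus n)$; (ii) if $\sigma\in D_n$ and $n$ lies in a $2$-cycle of $\sigma$, then $\sigma\setminus n\in E_{n-1}$; let $\rho=\alpha_{n-1}^{-1}(\sigma\setminus n)$. If $\rho\in D_{n-1}$, then $\alpha_n(\sigma)=f_n(n,\rho)$; if $\rho=\pi_{n-1}\in\Pi_{n-1}$ (possible only for $n$ even), then $\alpha_n(\sigma)=\pi_n\in\Pi_n$; (iii) if $n$ is odd and $\sigma=\pi_n\in\Pi_n$, then $\alpha_n(\pi_n)=f_n\big(n,\alpha_{n-1}^{-1}(\pi_{n-1})\big)$, where $\pi_{n-1}$ is regarded as the element of $\Pi_{n-1}$ in the domain of $\alpha_{n-1}^{-1}$.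 Define $\gamma_n:E_n\to D_{n+1}$ by sending $\sigma$ with unique fixed point $m$ to the permutation of $[n+1]$ that agrees with $\sigma$ on $[n]\setminus\{m\}$ and interchanges $m$ and $n+1$. Define $\lambda_n: D_n\cup E_n\to D_n\cup E_n$ by $\lambda_n(\sigma)=\alpha_n(\sigma)$ if $\sigma\in D_n$, and $\lambda_n(\sigma)=\alpha_{n+1}(\gamma_n(\sigma))\setminus(n+1)$ if $\sigma\in E_n$ (elements of $\Pi_k$ being regarded as the permutation $\pi_k$). *)

theory Defs
  imports Main "HOL-Combinatorics.Permutations" "HOL-Combinatorics.Orbits"
begin

text \<open>
  A permutation of a set \<open>A\<close> of naturals is a function \<open>nat \<Rightarrow> nat\<close> that \<open>permutes\<close> \<open>A\<close>,
  hence is the identity outside \<open>A\<close>. In particular a permutation of \<open>{1..n}\<close> and the same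
  permutation with the fixed point \<open>n + 1\<close> appended are the same function; the ground set is
  recorded by the index \<open>n\<close>.
\<close>

definition derangements :: "nat \<Rightarrow> (nat \<Rightarrow> nat) set" where
  "derangements n = {\<sigma>. \<sigma> permutes {1..n} \<and> (\<forall>x\<in>{1..n}. \<sigma> x \<noteq> x)}"

definition one_fixed :: "nat \<Rightarrow> (nat \<Rightarrow> nat) set" where
  "one_fixed n = {\<sigma>. \<sigma> permutes {1..n} \<and> (\<exists>!x. x \<in> {1..n} \<and> \<sigma> x = x)}"

text \<open>\<open>(1 2)(3 4)\<dots>\<close>, with the final fixed point \<open>n\<close> if \<open>n\<close> is odd.\<close>

definition pi_perm :: "nat \<Rightarrow> nat \<Rightarrow> nat" where
  "pi_perm n = (\<lambda>x. if odd x \<and> x < n then x + 1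
                     else if even x \<and> 0 < x \<and> x \<le> n then x - 1
                     else x)"

definition delete :: "(nat \<Rightarrow> nat) \<Rightarrow> nat \<Rightarrow> nat \<Rightarrow> nat" where
  "delete \<sigma> a = (\<lambda>x. if x = a then a else if \<sigma> x = a then \<sigma> a else \<sigma> x)"

text \<open>
  Only used for \<open>m \<in> {1..n}\<close> and \<open>\<sigma> \<in> derangements (n - 1)\<close>. In the case \<open>m = n\<close> the
  function \<open>\<sigma>\<close> already fixes \<open>n\<close>.
\<close>

definition f_map :: "nat \<Rightarrow> nat \<Rightarrow> (nat \<Rightarrow> nat) \<Rightarrow> nat \<Rightarrow> nat" where
  "f_map n m \<sigma> =
     (if m = n then \<sigma>
      else (\<lambda>x. if x = m then m
                 else if x = n then \<sigma> m
                 else if \<sigma> x = m then n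
                 else \<sigma> x))"

text \<open>
  \<open>pi_perm n\<close> is a derangement for even \<open>n\<close> and has exactly one fixed point for odd \<open>n\<close>, so
  the disjoint unions \<open>D\<^sub>n \<squnion> \<Pi>\<^sub>n\<close> (\<open>n\<close> odd) and \<open>E\<^sub>n \<squnion> \<Pi>\<^sub>n\<close> (\<open>n\<close> even) are
  ordinary unions and need no tags.
\<close>

definition alpha_source :: "nat \<Rightarrow> (nat \<Rightarrow> nat) set" where
  "alpha_source n = (if even n then derangements n else derangements n \<union> {pi_perm n})"

text \<open>
  Only the values of \<open>alpha n\<close> on \<open>alpha_source n\<close> matter; the inverse bijection of
  \<open>alpha (n - 1)\<close> is rendered by \<open>inv_into\<close> on that set. The cycle of \<open>\<sigma>\<close> through \<open>n\<close> is
  \<open>orbit \<sigma> n\<close>.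
\<close>

fun alpha :: "nat \<Rightarrow> (nat \<Rightarrow> nat) \<Rightarrow> (nat \<Rightarrow> nat)" where
  "alpha 0 = (\<lambda>\<sigma>. pi_perm 0)"
| "alpha (Suc 0) = (\<lambda>\<sigma>. pi_perm 1)"
| "alpha (Suc (Suc k)) = (\<lambda>\<sigma>.
     let n = Suc (Suc k);
         prev_inv = inv_into (alpha_source (Suc k)) (alpha (Suc k))
     in if \<sigma> \<in> derangements n \<and> card (orbit \<sigma> n) \<ge> 3 then
          f_map n (\<sigma> n) (delete \<sigma> n)
        else if \<sigma> \<in> derangements n \<and> card (orbit \<sigma> n) = 2 then
          (let \<rho> = prev_inv (delete \<sigma> n)
           in if \<rho> \<in> derangements (n - 1) then f_map n n \<rho> else pi_perm n)
        else if odd n \<and> \<sigma> = pi_perm n then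
          f_map n n (prev_inv (pi_perm (n - 1)))
        else undefined)"

definition gamma :: "nat \<Rightarrow> (nat \<Rightarrow> nat) \<Rightarrow> (nat \<Rightarrow> nat)" where
  "gamma n \<sigma> = (let m = (THE m. m \<in> {1..n} \<and> \<sigma> m = m) in \<sigma>(m := n + 1, n + 1 := m))"

text \<open>Only used on \<open>derangements n \<union> one_fixed n\<close>.\<close>

definition lambda_map :: "nat \<Rightarrow> (nat \<Rightarrow> nat) \<Rightarrow> (nat \<Rightarrow> nat)" where
  "lambda_map n \<sigma> =
     (if \<sigma> \<in> derangements n then alpha n \<sigma>
      else delete (alpha (n + 1) (gamma n \<sigma>)) (n + 1))"

end

theory Submission
  imports Defs
begin

text \<open>
  The key point is that \<open>\<lambda>\<^sub>n\<close> restricted to \<open>E\<^sub>n\<close> is \<open>\<alpha>\<^sub>n\<inverse>\<close>: the permutation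
  \<open>\<gamma>\<^sub>n(\<sigma>)\<close> has \<open>n + 1\<close> in a 2-cycle, so \<open>\<alpha>\<^bsub>n+1\<^esub>\<close> looks up \<open>\<alpha>\<^sub>n\<inverse>(\<sigma>)\<close>. As moreover
  \<open>\<alpha>\<^sub>n(\<pi>\<^sub>n) = \<pi>\<^sub>n\<close>, the claim follows from the bijectivity of \<open>\<alpha>\<^sub>n\<close>.
  For the latter, put \<open>\<tau> = \<sigma> \<circ> (n \<sigma>(n))\<close>, which fixes \<open>\<sigma>(n)\<close>; this equals
  \<open>f\<^sub>n(\<sigma>(n), \<sigma> \<setminus> n)\<close> in case (i) and \<open>\<sigma> \<setminus> n\<close> in case (ii). The map \<open>\<sigma> \<mapsto> \<tau>\<close> is a
  bijection from \<open>D\<^sub>n\<close> onto the permutations with exactly one fixed point below \<open>n\<close>, which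
  are the \<open>\<tau> \<in> E\<^sub>n\<close> moving \<open>n\<close> together with \<open>E\<^bsub>n-1\<^esub>\<close>; on the latter part \<open>\<alpha>\<^bsub>n-1\<^esub>\<inverse>\<close> is
  applied, by induction bijectively.
\<close>

definition split_off :: "nat \<Rightarrow> (nat \<Rightarrow> nat) \<Rightarrow> nat \<Rightarrow> nat" where
  "split_off n \<sigma> = \<sigma> \<circ> transpose n (\<sigma> n)"

definition one_fixed_below :: "nat \<Rightarrow> (nat \<Rightarrow> nat) set" where
  "one_fixed_below n = {\<tau>. \<tau> permutes {1..n} \<and> (\<exists>!x. x \<in> {1..<n} \<and> \<tau> x = x)}"

definition one_fixed_moving :: "nat \<Rightarrow> (nat \<Rightarrow> nat) set" where
  "one_fixed_moving n = {\<tau> \<in> one_fixed n. \<tau> n \<noteq> n}"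

definition alpha_target :: "nat \<Rightarrow> (nat \<Rightarrow> nat) set" where
  "alpha_target n = (if even n then one_fixed n \<union> {pi_perm n} else one_fixed n)"

section \<open>Fixed points and the last element\<close>

text \<open>Permutations are the identity outside their ground set, so appending the fixed point
  \<open>Suc n\<close> does not change the function.\<close>

lemma permutes_Suc_fixing_iff:
  "\<sigma> permutes {1..Suc n} \<and> \<sigma> (Suc n) = Suc n \<longleftrightarrow> \<sigma> permutes {1..n}"
proof
  assume A: "\<sigma> permutes {1..Suc n} \<and> \<sigma> (Suc n) = Suc n"
  show "\<sigma> permutes {1..n}"
    by (rule permutes_superset[of \<sigma> "{1..Suc n}"]) (use A in \<open>auto simp: le_Suc_eq\<close>)
next
  assume A: "\<sigma> permutes {1..n}"
  then show "\<sigma> permutes {1..Suc n} \<and> \<sigma> (Suc n) = Suc n"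
    by (auto intro: permutes_subset simp: permutes_not_in)
qed

text \<open>If the last point is fixed, it is the only fixed point. This is the image of
  \<open>f_map (Suc n) (Suc n)\<close>.\<close>

lemma one_fixed_Suc_fixing:
  "{\<tau> \<in> one_fixed (Suc n). \<tau> (Suc n) = Suc n} = derangements n" (is "?L = ?R")
proof (intro set_eqI iffI)
  fix \<tau> assume "\<tau> \<in> ?L"
  then have *: "\<tau> permutes {1..Suc n}" "\<tau> (Suc n) = Suc n"
    "\<exists>!x. x \<in> {1..Suc n} \<and> \<tau> x = x"
    by (auto simp: one_fixed_def)
  have "\<tau> x \<noteq> x" if "x \<in> {1..n}" for x
  proof
    assume "\<tau> x = x"
    moreover have "x \<in> {1..Suc n}" "Suc n \<in> {1..Suc n}" using that by auto
    ultimately have "x = Suc n" using *(2,3) by blast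
    then show False using that by simp
  qed
  then show "\<tau> \<in> ?R"
    using * permutes_Suc_fixing_iff by (auto simp: derangements_def)
next
  fix \<tau> assume "\<tau> \<in> ?R"
  then have "\<tau> permutes {1..n}" "\<And>x. x \<in> {1..n} \<Longrightarrow> \<tau> x \<noteq> x"
    by (auto simp: derangements_def)
  moreover from this(1) have "\<tau> permutes {1..Suc n}" "\<tau> (Suc n) = Suc n"
    using permutes_Suc_fixing_iff by blast+
  moreover have "\<exists>!x. x \<in> {1..Suc n} \<and> \<tau> x = x"
  proof (rule ex1I[of _ "Suc n"])
    fix x assume "x \<in> {1..Suc n} \<and> \<tau> x = x"
    with calculation(2) show "x = Suc n"
      by (metis atLeastAtMost_iff le_SucE)
  qed (use calculation in auto)
  ultimately show "\<tau> \<in> ?L" by (simp add: one_fixed_def)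
qed

text \<open>If \<open>Suc n\<close> is fixed, only its ground set shrinks; if it is moved, excluding
  it from the search for fixed points changes nothing.\<close>

lemma one_fixed_below_Suc:
  "one_fixed_below (Suc n) = one_fixed_moving (Suc n) \<union> one_fixed n"
proof (intro set_eqI)
  fix \<tau>
  have below: "{1..<Suc n} = {1..n}" by auto
  show "\<tau> \<in> one_fixed_below (Suc n) \<longleftrightarrow> \<tau> \<in> one_fixed_moving (Suc n) \<union> one_fixed n"
  proof (cases "\<tau> (Suc n) = Suc n")
    case True
    then have "\<tau> permutes {1..Suc n} \<longleftrightarrow> \<tau> permutes {1..n}"
      using permutes_Suc_fixing_iff[of \<tau> n] by blast
    then have "\<tau> \<in> one_fixed_below (Suc n) \<longleftrightarrow> \<tau> \<in> one_fixed n"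
      by (simp only: one_fixed_below_def one_fixed_def below mem_Collect_eq)
    with True show ?thesis by (simp add: one_fixed_moving_def)
  next
    case False
    then have "\<tau> \<notin> one_fixed n"
      using permutes_Suc_fixing_iff[of \<tau> n] by (auto simp: one_fixed_def)
    moreover have "x \<in> {1..Suc n} \<and> \<tau> x = x \<longleftrightarrow> x \<in> {1..n} \<and> \<tau> x = x" for x
      using False by (auto simp: le_Suc_eq)
    then have "\<tau> \<in> one_fixed_below (Suc n) \<longleftrightarrow> \<tau> \<in> one_fixed (Suc n)"
      by (simp only: one_fixed_below_def one_fixed_def below mem_Collect_eq)
    ultimately show ?thesis using False by (simp add: one_fixed_moving_def)
  qed
qed

lemma derangementsD:
  assumes "\<sigma> \<in> derangements n"
  shows "\<sigma> permutes {1..n}" and "x \<in> {1..n} \<Longrightarrow> \<sigma> x \<noteq> x"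
  using assms by (auto simp: derangements_def)

section \<open>Splitting off the last point as a bijection\<close>

lemma split_off_apply:
  "split_off n \<sigma> (\<sigma> n) = \<sigma> n"
  "split_off n \<sigma> n = \<sigma> (\<sigma> n)"
  "x \<noteq> n \<Longrightarrow> x \<noteq> \<sigma> n \<Longrightarrow> split_off n \<sigma> x = \<sigma> x"
  by (simp_all add: split_off_def)

lemma derangement_last_in:
  assumes "n > 0" "\<sigma> \<in> derangements n"
  shows "\<sigma> n \<in> {1..<n}"
proof -
  have "\<sigma> n \<in> {1..n}" "\<sigma> n \<noteq> n"
    using permutes_in_image[OF derangementsD(1)[OF assms(2)], of n]
      derangementsD(2)[OF assms(2), of n] assms(1) by simp_all
  then show ?thesis by auto
qed

lemma split_off_permutes:
  assumes "n > 0" "\<sigma> \<in> derangements n"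
  shows "split_off n \<sigma> permutes {1..n}"
  unfolding split_off_def
  using derangement_last_in[OF assms] assms(1)
  by (intro permutes_compose permutes_swap_id derangementsD(1)[OF assms(2)]) auto

text \<open>Below \<open>n\<close>, splitting off alters a derangement only at
  \<open>\<sigma> n\<close>, which becomes fixed.\<close>

lemma split_off_fixed_iff:
  assumes "n > 0" "\<sigma> \<in> derangements n" "x \<in> {1..<n}"
  shows "split_off n \<sigma> x = x \<longleftrightarrow> x = \<sigma> n"
  using assms derangementsD(2)[OF assms(2), of x]
  by (cases "x = \<sigma> n") (auto simp: split_off_apply)

text \<open>This inverts \<open>split_off\<close>, and \<open>gamma\<close> is an instance of it:
  \<open>n\<close> is put into a 2-cycle with \<open>m\<close> if \<open>\<tau>\<close> fixes
  \<open>n\<close>, and into a longer cycle otherwise.\<close>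

lemma insert_last:
  assumes "n > 0" "\<tau> permutes {1..n}" "m \<in> {1..<n}" "\<tau> m = m"
    and uniq: "\<And>x. x \<in> {1..<n} \<Longrightarrow> \<tau> x = x \<Longrightarrow> x = m"
  shows "\<tau> \<circ> transpose n m \<in> derangements n" and "split_off n (\<tau> \<circ> transpose n m) = \<tau>"
proof -
  have inj: "inj \<tau>" using assms(2) by (rule permutes_inj)
  have "(\<tau> \<circ> transpose n m) permutes {1..n}"
    using assms(1-3) by (intro permutes_compose permutes_swap_id) auto
  moreover have "(\<tau> \<circ> transpose n m) x \<noteq> x" if "x \<in> {1..n}" for x
  proof -
    consider "x = n" | "x = m" | "x \<noteq> n" "x \<noteq> m" by blast
    then show ?thesis
    proof cases
      case 1 with assms(3,4) show ?thesis by simp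
    next
      case 2
      then have "(\<tau> \<circ> transpose n m) x = \<tau> n" by simp
      moreover have "\<tau> n \<noteq> \<tau> m" using injD[OF inj, of n m] assms(3) by auto
      ultimately show ?thesis using 2 assms(4) by simp
    next
      case 3
      then have "x \<in> {1..<n}" using that by auto
      with 3 uniq[of x] show ?thesis by auto
    qed
  qed
  ultimately show "\<tau> \<circ> transpose n m \<in> derangements n" by (simp add: derangements_def)
  \<comment> \<open>The composite sends \<open>n\<close> to \<open>\<tau> m = m\<close>, so
    \<open>split_off\<close> applies the same transposition again and it cancels.\<close>
  show "split_off n (\<tau> \<circ> transpose n m) = \<tau>"
    using assms(4) by (simp add: split_off_def o_assoc[symmetric])
qed

lemma bij_betw_split_off:
  assumes "n > 0"
  shows "bij_betw (split_off n) (derangements n) (one_fixed_below n)"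
proof (rule bij_betwI')
  fix \<sigma> \<sigma>' assume *: "\<sigma> \<in> derangements n" "\<sigma>' \<in> derangements n"
  show "split_off n \<sigma> = split_off n \<sigma>' \<longleftrightarrow> \<sigma> = \<sigma>'"
  proof
    assume eq: "split_off n \<sigma> = split_off n \<sigma>'"
    \<comment> \<open>\<open>\<sigma> n\<close> is fixed by the common image, whose only fixed point
      below \<open>n\<close> is \<open>\<sigma>' n\<close>.\<close>
    have last: "\<sigma> n = \<sigma>' n"
      using split_off_fixed_iff[OF assms *(2) derangement_last_in[OF assms *(1)]]
      by (simp flip: eq add: split_off_apply)
    have "\<sigma> = split_off n \<sigma> \<circ> transpose n (\<sigma> n)" "\<sigma>' = split_off n \<sigma>' \<circ> transpose n (\<sigma>' n)"
      by (simp_all add: split_off_def o_assoc[symmetric])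
    then show "\<sigma> = \<sigma>'" using eq last by metis
  qed simp
next
  fix \<sigma> assume *: "\<sigma> \<in> derangements n"
  show "split_off n \<sigma> \<in> one_fixed_below n"
    unfolding one_fixed_below_def
    using split_off_permutes[OF assms *] split_off_fixed_iff[OF assms *]
      derangement_last_in[OF assms *]
    by blast
next
  fix \<tau> assume "\<tau> \<in> one_fixed_below n"
  then obtain m where "\<tau> permutes {1..n}" "m \<in> {1..<n}" "\<tau> m = m"
    "\<And>x. x \<in> {1..<n} \<Longrightarrow> \<tau> x = x \<Longrightarrow> x = m"
    unfolding one_fixed_below_def by blast
  from insert_last[OF assms this]
  show "\<exists>\<sigma>\<in>derangements n. \<tau> = split_off n \<sigma>" by metis
qed

section \<open>Cycle length and deletion of the last point\<close>

lemma orbit_two_cycle: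
  assumes "\<sigma> (\<sigma> n) = n"
  shows "orbit \<sigma> n = {n, \<sigma> n}"
proof
  have "x \<in> {n, \<sigma> n}" if "x \<in> orbit \<sigma> n" for x
    using that by induction (use assms in auto)
  then show "orbit \<sigma> n \<subseteq> {n, \<sigma> n}" by blast
  show "{n, \<sigma> n} \<subseteq> orbit \<sigma> n"
    using orbit.base[of \<sigma> n] orbit.step[OF orbit.base[of \<sigma> n]] assms by auto
qed

lemma card_orbit_ge_3:
  assumes "\<sigma> permutes S" "finite S" "n \<in> S" "\<sigma> n \<noteq> n" "\<sigma> (\<sigma> n) \<noteq> n"
  shows "card (orbit \<sigma> n) \<ge> 3"
proof -
  have "permutation \<sigma>" using assms(1,2) by (auto simp: permutation_permutes)
  \<comment> \<open>\<open>orbit\<close> starts at \<open>\<sigma> n\<close>; that it returns to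
    \<open>n\<close> relies on finiteness.\<close>
  then have "n \<in> orbit \<sigma> n" by (rule permutation_self_in_orbit)
  then have "{n, \<sigma> n, \<sigma> (\<sigma> n)} \<subseteq> orbit \<sigma> n"
    by (simp add: orbit.intros)
  moreover have "finite (orbit \<sigma> n)"
    using permutes_orbit_subset[OF assms(1,3)] assms(2) by (rule finite_subset)
  moreover have "\<sigma> n \<noteq> \<sigma> (\<sigma> n)"
    using assms(4) permutes_inj[OF assms(1)] by (metis injD)
  then have "card {n, \<sigma> n, \<sigma> (\<sigma> n)} = 3"
    using assms(4,5) by auto
  ultimately show ?thesis using card_mono by metis
qed

text \<open>Deletion sends the preimage of \<open>n\<close> to \<open>\<sigma> n\<close>, and
  \<open>f_map\<close> redirects it to \<open>n\<close> again. The net change is that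
  \<open>\<sigma> n\<close> becomes fixed and \<open>n\<close> takes over its image.\<close>

lemma f_map_delete_eq_split_off:
  assumes "inj \<sigma>" "\<sigma> n \<noteq> n" "\<sigma> (\<sigma> n) \<noteq> n"
  shows "f_map n (\<sigma> n) (delete \<sigma> n) = split_off n \<sigma>"
proof
  fix x
  show "f_map n (\<sigma> n) (delete \<sigma> n) x = split_off n \<sigma> x"
    using assms by (auto simp: f_map_def delete_def split_off_def transpose_def dest: injD)
qed

text \<open>The partner \<open>\<sigma> n\<close> is the preimage of \<open>n\<close>, so both
  points of the 2-cycle end up fixed.\<close>

lemma delete_two_cycle_eq_split_off:
  assumes "inj \<sigma>" "\<sigma> (\<sigma> n) = n"
  shows "delete \<sigma> n = split_off n \<sigma>"
proof
  fix x
  have "\<sigma> x = n \<longleftrightarrow> x = \<sigma> n"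
    using injD[OF assms(1), of x "\<sigma> n"] assms(2) by auto
  then show "delete \<sigma> n x = split_off n \<sigma> x"
    using assms(2) by (simp add: delete_def split_off_def transpose_def)
qed

section \<open>The permutations \<open>pi_perm n\<close>\<close>

lemma pi_perm_odd: "odd (Suc n) \<Longrightarrow> pi_perm (Suc n) = pi_perm n"
  by (auto simp: pi_perm_def fun_eq_iff less_Suc_eq le_Suc_eq)

lemma delete_pi_perm_even: "even (Suc n) \<Longrightarrow> delete (pi_perm (Suc n)) (Suc n) = pi_perm n"
  by (auto simp: pi_perm_def delete_def fun_eq_iff less_Suc_eq le_Suc_eq)

lemma pi_perm_permutes: "pi_perm n permutes {1..n}"
proof -
  have "pi_perm n (pi_perm n x) = x" for x by (auto simp: pi_perm_def elim!: oddE evenE)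
  then have "bij (pi_perm n)" by (rule involuntory_imp_bij)
  then show ?thesis
    by (auto simp: permutes_def pi_perm_def bij_iff)
qed

lemma pi_perm_derangement: "even n \<Longrightarrow> pi_perm n \<in> derangements n"
  using pi_perm_permutes[of n]
  by (auto simp: derangements_def pi_perm_def intro: le_neq_trans)

lemma pi_perm_one_fixed: "odd n \<Longrightarrow> pi_perm n \<in> one_fixed n"
  using one_fixed_Suc_fixing[of "n - 1"] pi_perm_derangement[of "n - 1"] pi_perm_odd[of "n - 1"]
  by (auto elim!: oddE)

lemma derangements_one_fixed_disjoint: "derangements n \<inter> one_fixed n = {}"
  unfolding derangements_def one_fixed_def by blast

section \<open>The recursion for \<open>alpha\<close> in terms of \<open>split_off\<close>\<close>

text \<open>Clause (ii) as a function of the permutation left after deletion. The index is that of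
  the lower level, so the default value is \<open>pi_perm (Suc n)\<close>.\<close>

definition prev_map :: "nat \<Rightarrow> (nat \<Rightarrow> nat) \<Rightarrow> nat \<Rightarrow> nat" where
  "prev_map n \<tau> =
     (let \<rho> = inv_into (alpha_source n) (alpha n) \<tau>
      in if \<rho> \<in> derangements n then \<rho> else pi_perm (Suc n))"

text \<open>The value of \<open>\<tau>\<close> at the last point is that of \<open>\<sigma>\<close>
  applied twice, so \<open>\<tau>\<close> fixes the last point exactly if it lies in a 2-cycle of
  \<open>\<sigma>\<close>.\<close>

lemma alpha_derangement:
  assumes "\<sigma> \<in> derangements (Suc (Suc k))"
  defines "\<tau> \<equiv> split_off (Suc (Suc k)) \<sigma>"
  shows "alpha (Suc (Suc k)) \<sigma> =
    (if \<tau> (Suc (Suc k)) \<noteq> Suc (Suc k) then \<tau> else prev_map (Suc k) \<tau>)"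
proof -
  let ?n = "Suc (Suc k)"
  have perm: "\<sigma> permutes {1..?n}" and ne: "\<sigma> ?n \<noteq> ?n"
    using derangementsD[OF assms(1)] by auto
  have inj: "inj \<sigma>" using perm by (rule permutes_inj)
  show ?thesis
  proof (cases "\<sigma> (\<sigma> ?n) = ?n")
    case True
    then have "card (orbit \<sigma> ?n) = 2" using ne by (simp add: orbit_two_cycle)
    then show ?thesis
      using True assms(1) delete_two_cycle_eq_split_off[OF inj True]
      by (simp add: Let_def split_off_apply \<tau>_def prev_map_def f_map_def)
  next
    case False
    then have "card (orbit \<sigma> ?n) \<ge> 3"
      using card_orbit_ge_3[OF perm _ _ ne] by simp
    then show ?thesis
      using False assms(1) f_map_delete_eq_split_off[OF inj ne False]
      by (simp add: Let_def split_off_apply \<tau>_def)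
  qed
qed

lemma alpha_pi_perm_odd:
  assumes "odd (Suc (Suc k))"
  shows "alpha (Suc (Suc k)) (pi_perm (Suc (Suc k))) =
    inv_into (alpha_source (Suc k)) (alpha (Suc k)) (pi_perm (Suc k))"
proof -
  have "pi_perm (Suc (Suc k)) \<notin> derangements (Suc (Suc k))"
    using pi_perm_one_fixed[OF assms] derangements_one_fixed_disjoint by blast
  then show ?thesis using assms by (simp add: Let_def f_map_def)
qed

declare alpha.simps(3) [simp del]

section \<open>Bijectivity of \<open>alpha\<close>\<close>

text \<open>\<open>prev_map n\<close> is the inverse of \<open>alpha n\<close> followed by
  \<open>?app\<close>, which for odd \<open>n\<close> replaces \<open>pi_perm n\<close> by
  \<open>pi_perm (Suc n)\<close> and for even \<open>n\<close> is the identity on the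
  source.\<close>

lemma bij_betw_prev_map:
  assumes "bij_betw (alpha n) (alpha_source n) (alpha_target n)"
  shows "bij_betw (prev_map n) (alpha_target n)
    (if odd n then derangements n \<union> {pi_perm (Suc n)} else derangements n)"
proof -
  let ?app = "\<lambda>\<rho>. if \<rho> \<in> derangements n then \<rho> else pi_perm (Suc n)"
  have id: "bij_betw ?app (derangements n) (derangements n)"
    by (rule iffD2[OF bij_betw_cong bij_betw_id]) simp
  have "bij_betw ?app (alpha_source n)
    (if odd n then derangements n \<union> {pi_perm (Suc n)} else derangements n)"
  proof (cases "odd n")
    case True
    then have "pi_perm n \<notin> derangements n"
      using pi_perm_one_fixed derangements_one_fixed_disjoint by blast
    then have "bij_betw ?app {pi_perm n} {pi_perm (Suc n)}" by (simp add: bij_betw_def)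
    \<comment> \<open>Elements of \<open>derangements n\<close> fix \<open>Suc n\<close>, which
      \<open>pi_perm (Suc n)\<close> moves.\<close>
    moreover have "pi_perm (Suc n) \<notin> derangements n"
    proof
      assume "pi_perm (Suc n) \<in> derangements n"
      then have "pi_perm (Suc n) (Suc n) = Suc n"
        using one_fixed_Suc_fixing[of n] by blast
      with True show False by (simp add: pi_perm_def odd_pos)
    qed
    ultimately have "bij_betw ?app (derangements n \<union> {pi_perm n})
      (derangements n \<union> {pi_perm (Suc n)})"
      by (intro bij_betw_combine[OF id]) auto
    with True show ?thesis by (simp add: alpha_source_def)
  next
    case False
    with id show ?thesis by (simp add: alpha_source_def)
  qed
  from bij_betw_trans[OF bij_betw_inv_into[OF assms] this] show ?thesis
    unfolding prev_map_def Let_def comp_def .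
qed

text \<open>On its source, \<open>alpha n\<close> factors as \<open>\<phi> \<circ> \<chi>\<close>.
  For odd \<open>n\<close>, \<open>\<chi>\<close> takes the extra source element to the extra target
  element of level \<open>n - 1\<close>; for even \<open>n\<close>, \<open>\<phi>\<close> produces
  the extra target element through the default of \<open>prev_map\<close>.\<close>

lemma bij_betw_alpha: "bij_betw (alpha n) (alpha_source n) (alpha_target n)"
proof (induction n rule: less_induct)
  case (less n)
  have D0: "derangements 0 = {pi_perm 0}" "one_fixed 0 = {}"
    by (auto simp: derangements_def one_fixed_def pi_perm_def fun_eq_iff)
  have "pi_perm (Suc 0) = pi_perm 0" by (rule pi_perm_odd) simp
  moreover have perm1: "\<sigma> = pi_perm 0" if "\<sigma> permutes {Suc 0..Suc 0}" for \<sigma>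
    using that by (auto simp: pi_perm_def fun_eq_iff)
  ultimately have D1: "derangements (Suc 0) = {}" "one_fixed (Suc 0) = {pi_perm (Suc 0)}"
    using pi_perm_one_fixed[of 1]
    by (auto simp: derangements_def one_fixed_def)
  consider "n = 0" | "n = 1" | k where "n = Suc (Suc k)"
    by (metis One_nat_def not0_implies_Suc)
  then show ?case
  proof cases
    case 1
    then show ?thesis by (simp add: alpha_source_def alpha_target_def bij_betw_def D0)
  next
    case 2
    then show ?thesis by (simp add: alpha_source_def alpha_target_def bij_betw_def D1)
  next
    case (3 k)
    let ?m = "Suc k"
    have n: "n = Suc ?m" "n > 0" and k: "n = Suc (Suc k)" using 3 by auto
    \<comment> \<open>This lets \<open>\<phi>\<close> tell the two parts of its domain apart by
      looking at \<open>n\<close> alone.\<close>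
    have fixm: "\<tau> n = n" if "\<tau> \<in> alpha_target ?m" for \<tau>
    proof -
      have "\<tau> permutes {1..?m}"
        using that pi_perm_permutes[of ?m]
        by (auto simp: alpha_target_def one_fixed_def split: if_splits)
      then show ?thesis by (simp add: n permutes_not_in)
    qed
    \<comment> \<open>The default value encodes clause (iii): on the source it is reached only at
      \<open>pi_perm n\<close> with \<open>n\<close> odd.\<close>
    define \<chi> where "\<chi> = (\<lambda>\<sigma>. if \<sigma> \<in> derangements n then split_off n \<sigma> else pi_perm ?m)"
    define \<phi> where "\<phi> = (\<lambda>\<tau>. if \<tau> n \<noteq> n then \<tau> else prev_map ?m \<tau>)"
    have \<chi>D: "bij_betw \<chi> (derangements n) (one_fixed_moving n \<union> one_fixed ?m)"
      using iffD2[OF bij_betw_cong bij_betw_split_off[OF n(2)], of \<chi>] one_fixed_below_Suc[of ?m]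
      by (simp add: \<chi>_def n(1)[symmetric])
    have \<chi>: "bij_betw \<chi> (alpha_source n) (one_fixed_moving n \<union> alpha_target ?m)"
    proof (cases "odd n")
      case True
      then have "pi_perm n \<notin> derangements n"
        using pi_perm_one_fixed derangements_one_fixed_disjoint by blast
      then have "bij_betw \<chi> {pi_perm n} {pi_perm ?m}" by (simp add: bij_betw_def \<chi>_def)
      moreover have "even ?m" using True n by simp
      then have "pi_perm ?m \<notin> one_fixed ?m"
        using pi_perm_derangement derangements_one_fixed_disjoint by blast
      moreover have "pi_perm ?m \<notin> one_fixed_moving n"
        using fixm[of "pi_perm ?m"] \<open>even ?m\<close>
        by (simp add: alpha_target_def one_fixed_moving_def)
      ultimately have "bij_betw \<chi> (derangements n \<union> {pi_perm n})
        ((one_fixed_moving n \<union> one_fixed ?m) \<union> {pi_perm ?m})"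
        by (intro bij_betw_combine[OF \<chi>D]) auto
      with True \<open>even ?m\<close> show ?thesis
        by (simp add: alpha_source_def alpha_target_def Un_assoc)
    next
      case False
      with \<chi>D n show ?thesis by (simp add: alpha_source_def alpha_target_def)
    qed
    let ?R = "if odd ?m then derangements ?m \<union> {pi_perm (Suc ?m)} else derangements ?m"
    have "bij_betw \<phi> (one_fixed_moving n) (one_fixed_moving n)"
      by (intro iffD2[OF bij_betw_cong bij_betw_id]) (simp add: \<phi>_def one_fixed_moving_def)
    moreover have "bij_betw \<phi> (alpha_target ?m) ?R"
      using less[of ?m] n fixm
      by (intro iffD2[OF bij_betw_cong bij_betw_prev_map]) (auto simp: \<phi>_def)
    moreover have E: "one_fixed n = one_fixed_moving n \<union> derangements ?m"
      "one_fixed_moving n \<inter> derangements ?m = {}"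
      using one_fixed_Suc_fixing[of ?m] by (auto simp: one_fixed_moving_def n)
    \<comment> \<open>The derangements of level \<open>?m\<close> fix \<open>n\<close>; for odd
      \<open>?m\<close>, \<open>pi_perm n\<close> is itself a derangement, so it has no fixed
      point.\<close>
    have "one_fixed_moving n \<inter> ?R = {}"
    proof (cases "odd ?m")
      case True
      then have "pi_perm n \<notin> one_fixed n"
        using pi_perm_derangement[of n] derangements_one_fixed_disjoint[of n] n by auto
      with E True show ?thesis by (auto simp flip: n(1))
    qed (use E in auto)
    ultimately have "bij_betw \<phi> (one_fixed_moving n \<union> alpha_target ?m) (one_fixed_moving n \<union> ?R)"
      by (rule bij_betw_combine)
    also have "one_fixed_moving n \<union> ?R = alpha_target n"
      using E(1) by (auto simp: alpha_target_def n(1))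
    finally have "bij_betw (\<phi> \<circ> \<chi>) (alpha_source n) (alpha_target n)"
      by (rule bij_betw_trans[OF \<chi>])
    moreover have "alpha n \<sigma> = (\<phi> \<circ> \<chi>) \<sigma>" if "\<sigma> \<in> alpha_source n" for \<sigma>
    proof (cases "\<sigma> \<in> derangements n")
      case True
      then show ?thesis using alpha_derangement[of \<sigma> k] by (simp add: \<phi>_def \<chi>_def k)
    next
      case False
      with that have odd: "odd n" and \<sigma>: "\<sigma> = pi_perm n"
        by (auto simp: alpha_source_def split: if_splits)
      then have "pi_perm ?m \<in> alpha_target ?m" "even ?m" by (auto simp: alpha_target_def n)
      \<comment> \<open>As \<open>?m\<close> is even, this preimage is a derangement, so
        \<open>prev_map\<close> returns it rather than its default.\<close>
      moreover from this(1) have "inv_into (alpha_source ?m) (alpha ?m) (pi_perm ?m) \<in> alpha_source ?m"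
        using bij_betwE[OF bij_betw_inv_into[OF less[of ?m]]] n by blast
      ultimately show ?thesis
        using False odd fixm[of "pi_perm ?m"] alpha_pi_perm_odd[of k]
        by (simp add: \<phi>_def \<chi>_def \<sigma> k prev_map_def alpha_source_def)
    qed
    ultimately show ?thesis using bij_betw_cong by metis
  qed
qed

section \<open>The values of \<open>lambda_map\<close>\<close>

lemma alpha_inv_eqI:
  assumes "\<sigma> \<in> alpha_source n" "alpha n \<sigma> = \<tau>"
  shows "inv_into (alpha_source n) (alpha n) \<tau> = \<sigma>"
  using bij_betw_inv_into_left[OF bij_betw_alpha assms(1)] assms(2) by simp

lemma pi_perm_in_alpha_source: "pi_perm n \<in> alpha_source n"
  using pi_perm_derangement by (simp add: alpha_source_def)

text \<open>By induction \<open>pi_perm\<close> of the previous level is its own preimage. For odd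
  index it is the same function as the new one; for even index the last 2-cycle is removed and, that
  preimage being no derangement, the default restores \<open>pi_perm\<close>.\<close>

lemma alpha_pi_perm: "alpha n (pi_perm n) = pi_perm n"
proof (induction n)
  case (Suc m)
  consider "m = 0" | k where "m = Suc k" by (cases m) auto
  then show ?case
  proof cases
    case 1
    then show ?thesis by simp
  next
    case (2 k)
    let ?m = "Suc k"
    have inv: "inv_into (alpha_source ?m) (alpha ?m) (pi_perm ?m) = pi_perm ?m"
      using alpha_inv_eqI[OF pi_perm_in_alpha_source] Suc 2 by blast
    show ?thesis
    proof (cases "odd (Suc ?m)")
      case True
      then show ?thesis using alpha_pi_perm_odd[OF True] inv pi_perm_odd[OF True] 2 by simp
    next
      case False
      let ?\<pi> = "pi_perm (Suc ?m)"
      have ev: "even (Suc ?m)" using False by simp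
      have D: "?\<pi> \<in> derangements (Suc ?m)" using pi_perm_derangement[OF ev] .
      have two: "?\<pi> (?\<pi> (Suc ?m)) = Suc ?m" using ev by (auto simp: pi_perm_def)
      have "split_off (Suc ?m) ?\<pi> = pi_perm ?m"
        using delete_two_cycle_eq_split_off[OF permutes_inj[OF pi_perm_permutes] two]
          delete_pi_perm_even[OF ev] by simp
      moreover have "pi_perm ?m \<notin> derangements ?m"
        using pi_perm_one_fixed[of ?m] derangements_one_fixed_disjoint[of ?m] ev by auto
      ultimately show ?thesis
        using alpha_derangement[OF D] two inv 2
        by (simp add: prev_map_def split_off_apply(2)[symmetric])
    qed
  qed
qed simp

text \<open>\<open>prev_map n\<close> differs from the inverse of \<open>alpha n\<close> only where
  the preimage is \<open>pi_perm n\<close> with \<open>n\<close> odd. Deleting \<open>n + 1\<close>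
  turns the default back into \<open>pi_perm n\<close> and leaves derangements of level
  \<open>n\<close> unchanged.\<close>

lemma lambda_map_one_fixed:
  assumes "n \<ge> 1" "\<sigma> \<in> one_fixed n"
  shows "lambda_map n \<sigma> = inv_into (alpha_source n) (alpha n) \<sigma>"
proof -
  obtain k where n: "n = Suc k" using assms(1) by (cases n) auto
  define m where "m = (THE m. m \<in> {1..n} \<and> \<sigma> m = m)"
  have perm: "\<sigma> permutes {1..n}" and "\<exists>!m. m \<in> {1..n} \<and> \<sigma> m = m"
    using assms(2) unfolding one_fixed_def by blast+
  from theI'[OF this(2)] this(2) have m: "m \<in> {1..n}" "\<sigma> m = m"
    and uniq: "\<And>x. x \<in> {1..n} \<Longrightarrow> \<sigma> x = x \<Longrightarrow> x = m"
    unfolding m_def by blast+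
  have perm': "\<sigma> permutes {1..Suc n}" and last: "\<sigma> (Suc n) = Suc n"
    using perm permutes_Suc_fixing_iff by blast+
  \<comment> \<open>Overwriting the values at two fixed points by each other is composition with
    their transposition.\<close>
  have "gamma n \<sigma> = \<sigma> \<circ> transpose (Suc n) m"
    unfolding gamma_def m_def[symmetric] Let_def
    using m last by (auto simp: fun_eq_iff transpose_def)
  moreover have "m \<in> {1..<Suc n}" using m(1) by simp
  moreover have "x = m" if "x \<in> {1..<Suc n}" "\<sigma> x = x" for x
    using uniq[of x] that by simp
  ultimately have D: "gamma n \<sigma> \<in> derangements (Suc n)"
    and split: "split_off (Suc n) (gamma n \<sigma>) = \<sigma>"
    using insert_last[OF zero_less_Suc perm' _ m(2)] by metis+
  let ?\<rho> = "inv_into (alpha_source n) (alpha n) \<sigma>"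
  \<comment> \<open>What is split off here is \<open>\<sigma>\<close>, which fixes
    \<open>Suc n\<close>, so the \<open>prev_map\<close> branch applies.\<close>
  have "alpha (Suc n) (gamma n \<sigma>) = prev_map n \<sigma>"
    using alpha_derangement[of "gamma n \<sigma>" k] D split last by (simp add: n)
  then have eq: "lambda_map n \<sigma> = delete (prev_map n \<sigma>) (Suc n)"
    using assms(2) derangements_one_fixed_disjoint[of n] by (auto simp: lambda_map_def)
  have "\<sigma> \<in> alpha_target n" using assms(2) by (simp add: alpha_target_def)
  then have \<rho>: "?\<rho> \<in> alpha_source n"
    using bij_betwE[OF bij_betw_inv_into[OF bij_betw_alpha]] by blast
  show ?thesis
  proof (cases "?\<rho> \<in> derangements n")
    case True
    then have "?\<rho> permutes {1..Suc n}" "?\<rho> (Suc n) = Suc n"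
      using derangementsD(1) permutes_Suc_fixing_iff by blast+
    then have "delete ?\<rho> (Suc n) = ?\<rho>"
      by (auto simp: delete_def fun_eq_iff)
    with True eq show ?thesis by (simp add: prev_map_def)
  next
    case False
    then have "odd n" "?\<rho> = pi_perm n" using \<rho> by (auto simp: alpha_source_def split: if_splits)
    then show ?thesis using False eq delete_pi_perm_even[of n] by (simp add: prev_map_def)
  qed
qed

theorem theorem2:
  fixes n :: nat and \<sigma> :: "nat \<Rightarrow> nat"
  assumes "n \<ge> 1"
    and "\<sigma> \<in> derangements n \<union> one_fixed n"
    and "\<sigma> \<noteq> pi_perm n"
  shows "(\<sigma> \<in> derangements n \<longrightarrow> lambda_map n \<sigma> \<in> one_fixed n)
       \<and> (\<sigma> \<in> one_fixed n \<longrightarrow> lambda_map n \<sigma> \<in> derangements n)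
       \<and> lambda_map n (lambda_map n \<sigma>) = \<sigma>"
proof (cases "\<sigma> \<in> derangements n")
  case True
  then have src: "\<sigma> \<in> alpha_source n" by (simp add: alpha_source_def)
  \<comment> \<open>Since \<open>pi_perm n\<close> is its own image, injectivity keeps
    \<open>\<sigma>\<close> away from the extra target element.\<close>
  have "alpha n \<sigma> \<noteq> alpha n (pi_perm n)"
    using inj_onD[OF bij_betw_imp_inj_on[OF bij_betw_alpha[of n]] _ src pi_perm_in_alpha_source] assms(3)
    by blast
  moreover have "alpha n \<sigma> \<in> alpha_target n" using bij_betwE[OF bij_betw_alpha] src by blast
  ultimately have "alpha n \<sigma> \<in> one_fixed n"
    by (auto simp: alpha_pi_perm alpha_target_def split: if_splits)
  moreover have "lambda_map n \<sigma> = alpha n \<sigma>" using True by (simp add: lambda_map_def)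
  moreover have "\<sigma> \<notin> one_fixed n" using True derangements_one_fixed_disjoint by blast
  ultimately show ?thesis
    using lambda_map_one_fixed[OF assms(1)] alpha_inv_eqI[OF src refl] by simp
next
  case False
  with assms(2) have E: "\<sigma> \<in> one_fixed n" by blast
  then have tgt: "\<sigma> \<in> alpha_target n" by (simp add: alpha_target_def)
  let ?\<rho> = "inv_into (alpha_source n) (alpha n) \<sigma>"
  have \<rho>: "alpha n ?\<rho> = \<sigma>"
    using bij_betw_inv_into_right[OF bij_betw_alpha tgt] .
  \<comment> \<open>Dually, the preimage avoids the extra source element that is present for odd
    \<open>n\<close>.\<close>
  then have "?\<rho> \<noteq> pi_perm n" using assms(3) alpha_pi_perm by metis
  moreover have "?\<rho> \<in> alpha_source n"
    using bij_betwE[OF bij_betw_inv_into[OF bij_betw_alpha]] tgt by blast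
  ultimately have "?\<rho> \<in> derangements n"
    by (auto simp: alpha_source_def split: if_splits)
  then show ?thesis
    using False lambda_map_one_fixed[OF assms(1) E] \<rho> by (simp add: lambda_map_def)
qed

end
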